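(* Let $D(y)=yF_0+y'F_1+y''F_2$ be a second order differential operator with $N\times N$ matrix-function coefficients on an open set $\Omega\subset\mathbb R$. Let $P$ be an eigenfunction of $D$, $D(P)=\Gamma P$ with $\Gamma$ a constant $N\times N$ matrix, and let $U$ be any matrix function on $\Omega$, such that $P(t),P'(t),U(t)$ are invertible for $t\in\Omega$. Define $A_0=-U$, $A_1=(P')^{-1}PU$ and the first order differential operator $$\mathcal A(y)=yA_0+y'A_1=-yU+y'(P')^{-1}PU$$ (so that $\mathcal A(P)=0$). Put $$B_1=A_1^{-1}F_2,\quad B_0=A_1^{-1}(F_1-A_0B_1-A_1'B_1),\quad \mathcal B(y)=yB_0+y'B_1,\quad \Psi=\mathcal B(A_0)-F_0 .$$ Then $\Psi$ satisfies $$\mathcal A(\Psi)=A_0A_1^{-1}\Psi A_1 .$$ Hence, for the second order differential operator $\mathcal D(y)=\mathcal A(\mathcal B(y))-yA_1^{-1}\Psi A_1$ and for every eigenfunction $Q$ of $D$, $D(Q)=\Gamma_QQ$ with $\Gamma_Q$ a constant matrix, the function $\mathcal Q=\mathcal A(Q)$ satisfies $\mathcal D(\mathcal Q)=\Gamma_Q\mathcal Q$.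
   Context: All functions are $N\times N$ matrix functions on an open set $\Omega\subset\mathbb R$, assumed differentiable as many times as needed for all the expressions to make sense. Differential operators have their coefficients multiplying on the right; eigenvalues are constant matrices multiplying on the left. *)

theory Defs
  imports "HOL-Analysis.Analysis"
begin

(* Matrix functions on an open set Omega are represented by total functions on the reals.
   Only their values on Omega matter: for t in Omega, the derivative at t depends only on
   values near t. *)
definition mderiv ::
  "(real \<Rightarrow> 'a::real_normed_field^'n^'n) \<Rightarrow> real \<Rightarrow> 'a^'n^'n" where
  "mderiv y = (\<lambda>t. vector_derivative y (at t))"

definition times_differentiable_on ::
  "nat \<Rightarrow> real set \<Rightarrow> (real \<Rightarrow> 'a::real_normed_field^'n^'n) \<Rightarrow> bool" where
  "times_differentiable_on k \<Omega> y \<longleftrightarrow> (\<forall>j<k. (mderiv ^^ j) y differentiable_on \<Omega>)"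

definition diff_op1 ::
  "(real \<Rightarrow> 'a::real_normed_field^'n^'n) \<Rightarrow> (real \<Rightarrow> 'a^'n^'n) \<Rightarrow>
   (real \<Rightarrow> 'a^'n^'n) \<Rightarrow> real \<Rightarrow> 'a^'n^'n" where
  "diff_op1 A0 A1 y = (\<lambda>t. y t ** A0 t + mderiv y t ** A1 t)"

definition diff_op2 ::
  "(real \<Rightarrow> 'a::real_normed_field^'n^'n) \<Rightarrow> (real \<Rightarrow> 'a^'n^'n) \<Rightarrow> (real \<Rightarrow> 'a^'n^'n) \<Rightarrow>
   (real \<Rightarrow> 'a^'n^'n) \<Rightarrow> real \<Rightarrow> 'a^'n^'n" where
  "diff_op2 F0 F1 F2 y =
     (\<lambda>t. y t ** F0 t + mderiv y t ** F1 t + mderiv (mderiv y) t ** F2 t)"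

(* As for diff_op2, the leading coefficient is not required to be nonzero. *)
definition second_order_diff_op_on ::
  "real set \<Rightarrow> ((real \<Rightarrow> 'a::real_normed_field^'n^'n) \<Rightarrow> real \<Rightarrow> 'a^'n^'n) \<Rightarrow> bool" where
  "second_order_diff_op_on \<Omega> L \<longleftrightarrow>
     (\<exists>G0 G1 G2. \<forall>y. times_differentiable_on 2 \<Omega> y \<longrightarrow>
        (\<forall>t\<in>\<Omega>. L y t = diff_op2 G0 G1 G2 y t))"

(* The eigenvalue is a constant matrix multiplying on the left. *)
definition eigenfunction_on ::
  "real set \<Rightarrow> ((real \<Rightarrow> 'a::real_normed_field^'n^'n) \<Rightarrow> real \<Rightarrow> 'a^'n^'n) \<Rightarrow>
   'a^'n^'n \<Rightarrow> (real \<Rightarrow> 'a^'n^'n) \<Rightarrow> bool" where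
  "eigenfunction_on \<Omega> L \<Gamma> y \<longleftrightarrow> (\<forall>t\<in>\<Omega>. L y t = \<Gamma> ** y t)"

end

theory Submission
  imports Defs
begin

text \<open>
  The coefficients \<open>B0\<close>, \<open>B1\<close>, \<open>\<Psi>\<close> are chosen so that \<open>\<B> (\<A> y) = y \<Psi> + D y\<close> for every \<open>y\<close>. Since \<open>\<A> P = 0\<close>,
  this gives \<open>P \<Psi> = - \<Gamma> P\<close>; in particular \<open>\<Psi> = - P\<^sup>-\<^sup>1 \<Gamma> P\<close> is differentiable,
  which its definition does not show. Applying \<open>\<A>\<close> to \<open>P \<Psi> = - \<Gamma> P\<close> gives \<open>P \<A>(\<Psi>) + P' \<Psi> A1 = 0\<close>, and
  \<open>P' = - P A0 A1\<^sup>-\<^sup>1\<close> yields the equation for \<open>\<A>(\<Psi>)\<close>. For an eigenfunction \<open>Q\<close>, applying \<open>\<A>\<close> to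
  \<open>\<B> (\<A> Q) = Q \<Psi> + \<Gamma>\<^sub>Q Q\<close> then gives \<open>\<A> (\<B> (\<A> Q)) = \<A>(Q) A1\<^sup>-\<^sup>1 \<Psi> A1 + \<Gamma>\<^sub>Q \<A>(Q)\<close>.
\<close>

section \<open>Norm bounds and entrywise differentiability of matrix functions\<close>

lemma norm_vec_le_sum: "norm (x :: 'a::real_normed_vector^'n) \<le> (\<Sum>i\<in>UNIV. norm (x $ i))"
  by (simp add: norm_vec_def L2_set_le_sum)

text \<open>Source of the product rule for matrix functions. For the bound, each entry of
  \<open>A ** B\<close> is a sum of \<open>CARD('n)\<close> products of entries, each at most
  \<open>norm A * norm B\<close>, and the norm of a matrix is at most the sum of the norms of its
  entries.\<close>

lemma bounded_bilinear_matrix_matrix_mult: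
  "bounded_bilinear ((**) :: 'a::real_normed_field^'n^'m \<Rightarrow> 'a^'p^'n \<Rightarrow> 'a^'p^'m)"
proof
  fix A A' :: "'a^'n^'m" and B B' :: "'a^'p^'n" and r :: real
  show "(A + A') ** B = A ** B + A' ** B" "A ** (B + B') = A ** B + A ** B'"
    "(r *\<^sub>R A) ** B = r *\<^sub>R (A ** B)" "A ** (r *\<^sub>R B) = r *\<^sub>R (A ** B)"
    by (simp_all add: matrix_matrix_mult_def vec_eq_iff algebra_simps sum.distrib scaleR_sum_right)
next
  have "norm (A ** B) \<le> norm A * norm B * real (CARD('m) * CARD('p) * CARD('n))"
    for A :: "'a^'n^'m" and B :: "'a^'p^'n"
  proof -
    have entry: "norm (A $ i $ k * B $ k $ j) \<le> norm A * norm B" for i k j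
    proof -
      have "norm (A $ i $ k) \<le> norm A" "norm (B $ k $ j) \<le> norm B"
        by (meson Finite_Cartesian_Product.norm_nth_le order_trans)+
      then show ?thesis
        unfolding norm_mult by (intro mult_mono) auto
    qed
    have "norm (A ** B) \<le> (\<Sum>i\<in>UNIV. \<Sum>j\<in>UNIV. norm ((A ** B) $ i $ j))"
      by (rule order_trans[OF norm_vec_le_sum sum_mono[OF norm_vec_le_sum]])
    also have "\<dots> \<le> (\<Sum>i\<in>(UNIV::'m set). \<Sum>j\<in>(UNIV::'p set). \<Sum>k\<in>(UNIV::'n set). norm A * norm B)"
      unfolding matrix_matrix_mult_def vec_lambda_beta
      by (intro sum_mono order_trans[OF norm_sum] entry)
    finally show ?thesis
      by (simp add: mult_ac)
  qed
  then show "\<exists>K. \<forall>(A::'a^'n^'m) (B::'a^'p^'n). norm (A ** B) \<le> norm A * norm B * K"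
    by blast
qed

interpretation matrix_mult: bounded_bilinear
  "(**) :: 'a::real_normed_field^'n^'m \<Rightarrow> 'a^'p^'n \<Rightarrow> 'a^'p^'m"
  by (rule bounded_bilinear_matrix_matrix_mult)

lemma bounded_linear_axis: "bounded_linear (axis i :: 'a::real_normed_vector \<Rightarrow> 'a^'n)"
proof (rule bounded_linear_intro[where K = 1])
  show "norm (axis i x :: 'a^'n) \<le> norm x * 1" for x
    using norm_vec_le_sum[of "axis i x :: 'a^'n"]
    by (simp add: axis_def if_distrib[of norm] cong: if_cong)
qed (simp_all add: axis_def vec_eq_iff)

text \<open>A vector function is the finite sum of its components, each placed on its axis by a
  bounded linear map. This reduces the differentiability of a matrix inverse to that of its
  entries.\<close>

lemma differentiable_vecI:
  fixes f :: "'b::real_normed_vector \<Rightarrow> 'a::real_normed_vector^'n"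
  assumes "\<And>i. (\<lambda>x. f x $ i) differentiable F"
  shows "f differentiable F"
proof -
  have "(\<lambda>x. axis i (f x $ i) :: 'a^'n) differentiable F" for i
    using assms[of i] bounded_linear.has_derivative[OF bounded_linear_axis]
    unfolding differentiable_def by blast
  then have "(\<lambda>x. \<Sum>i\<in>UNIV. axis i (f x $ i) :: 'a^'n) differentiable F"
    by (intro differentiable_sum) auto
  moreover have "(\<lambda>x. \<Sum>i\<in>UNIV. axis i (f x $ i)) = f"
    by (simp add: fun_eq_iff vec_eq_iff axis_def)
  ultimately show ?thesis
    by simp
qed

lemma differentiable_vec_nth:
  fixes f :: "'b::real_normed_vector \<Rightarrow> 'a::real_normed_vector^'n"
  shows "f differentiable F \<Longrightarrow> (\<lambda>x. f x $ i) differentiable F"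
  using bounded_linear.has_derivative[OF bounded_linear_vec_nth]
  unfolding differentiable_def by blast

text \<open>By the Leibniz formula the determinant is a polynomial in the entries.\<close>

lemma differentiable_det:
  fixes f :: "'b::real_normed_vector \<Rightarrow> 'a::real_normed_field^'n^'n"
  assumes "\<And>i j. (\<lambda>x. f x $ i $ j) differentiable at x within S"
  shows "(\<lambda>x. det (f x)) differentiable at x within S"
proof -
  have "(\<lambda>x. \<Prod>i\<in>I. f x $ i $ p i) differentiable at x within S" if "finite I" for p I
    using that by induction (simp_all add: assms)
  then show ?thesis
    unfolding det_def by (intro differentiable_sum differentiable_mult) (auto simp: finite_permutations)
qed

section \<open>The inverse of a matrix function and its differentiability\<close>

lemma matrix_inv_left_right:
  fixes A :: "'a::field^'n^'n"
  assumes "invertible A"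
  shows "A ** matrix_inv A = mat 1" "matrix_inv A ** A = mat 1"
  using assms someI_ex[of "\<lambda>A'. A ** A' = mat 1 \<and> A' ** A = mat 1"]
  unfolding invertible_def matrix_inv_def by auto

lemma invertible_matrix_inv:
  fixes A :: "'a::field^'n^'n"
  shows "invertible A \<Longrightarrow> invertible (matrix_inv A)"
  using matrix_inv_left_right unfolding invertible_def by blast

lemma matrix_inv_cancel:
  fixes A B :: "'a::field^'n^'n"
  assumes "invertible A"
  shows "A ** (matrix_inv A ** B) = B" "matrix_inv A ** (A ** B) = B"
  using matrix_inv_left_right[OF assms] by (simp_all add: matrix_mul_assoc)

text \<open>
  Cramer's rule is what makes the inverse differentiable: \<open>'a\<close> need not be complete, so the
  Neumann series is not available.
\<close>

lemma matrix_inv_cramer: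
  fixes A :: "'a::field^'n^'n"
  assumes "invertible A"
  shows "matrix_inv A $ k $ l = det (\<chi> i j. if j = k then mat 1 $ i $ l else A $ i $ j) / det A"
proof -
  \<comment> \<open>Column \<open>l\<close> of the inverse solves the linear system whose right-hand
    side is the unit vector \<open>l\<close>.\<close>
  have "A *v (\<chi> i. matrix_inv A $ i $ l) = (\<chi> i. (A ** matrix_inv A) $ i $ l)"
    by (simp add: matrix_vector_mult_def matrix_matrix_mult_def)
  also have "\<dots> = (\<chi> i. mat 1 $ i $ l)"
    by (simp add: matrix_inv_left_right assms)
  finally have "(\<chi> i. matrix_inv A $ i $ l) =
      (\<chi> k. det (\<chi> i j. if j = k then mat 1 $ i $ l else A $ i $ j) / det A)"
    using assms by (simp add: cramer invertible_det_nz cong: if_cong)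
  then show ?thesis
    by (simp add: vec_eq_iff)
qed

lemma differentiable_transform_open:
  assumes "f differentiable at t" "open S" "t \<in> S" "\<And>s. s \<in> S \<Longrightarrow> f s = g s"
  shows "g differentiable at t"
  using assms has_derivative_transform_within_open unfolding differentiable_def by metis

text \<open>Each entry is a quotient of determinants with nonzero denominator. Invertibility on all
  of \<open>S\<close> makes this formula valid near \<open>t\<close>, not just at
  \<open>t\<close>.\<close>

lemma differentiable_matrix_inv:
  fixes f :: "real \<Rightarrow> 'a::real_normed_field^'n^'n"
  assumes "open S" "t \<in> S" "\<And>s. s \<in> S \<Longrightarrow> invertible (f s)" "f differentiable at t"
  shows "(\<lambda>s. matrix_inv (f s)) differentiable at t"
proof (intro differentiable_vecI)
  fix k l
  have entry: "(\<lambda>s. f s $ i $ j) differentiable at t" for i j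
    by (intro differentiable_vec_nth assms)
  have "(\<lambda>s. if j = k then mat 1 $ i $ l else f s $ i $ j) differentiable at t" for i j
    by (cases "j = k") (simp_all add: entry)
  then have "(\<lambda>s. det (\<chi> i j. if j = k then mat 1 $ i $ l else f s $ i $ j) / det (f s)) differentiable at t"
    using assms(2,3) entry
    by (intro differentiable_divide differentiable_det) (auto simp: invertible_det_nz)
  then show "(\<lambda>s. matrix_inv (f s) $ k $ l) differentiable at t"
    by (rule differentiable_transform_open) (use assms in \<open>auto simp: matrix_inv_cramer\<close>)
qed

section \<open>Pointwise calculus with \<open>mderiv\<close>\<close>

lemma times_differentiable_on_iff:
  assumes "open S"
  shows "times_differentiable_on 1 S y \<longleftrightarrow> (\<forall>t\<in>S. y differentiable at t)"
    and "times_differentiable_on 2 S y \<longleftrightarrow>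
      (\<forall>t\<in>S. y differentiable at t \<and> mderiv y differentiable at t)"
  using assms
  by (auto simp: times_differentiable_on_def less_2_cases_iff all_conj_distrib
      differentiable_on_eq_differentiable_at)

lemma has_mderiv:
  "y differentiable at t \<Longrightarrow> (y has_vector_derivative mderiv y t) (at t)"
  by (simp add: mderiv_def vector_derivative_works)

lemma mderiv_eqI: "(y has_vector_derivative y') (at t) \<Longrightarrow> mderiv y t = y'"
  by (simp add: mderiv_def vector_derivative_at)

lemma mderiv_add:
  assumes "f differentiable at t" "g differentiable at t"
  shows "mderiv (\<lambda>t. f t + g t) t = mderiv f t + mderiv g t"
  using assms by (intro mderiv_eqI has_vector_derivative_add has_mderiv)

lemma mderiv_mult:
  assumes "f differentiable at t" "g differentiable at t"
  shows "mderiv (\<lambda>t. f t ** g t) t = f t ** mderiv g t + mderiv f t ** g t"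
  using assms by (intro mderiv_eqI matrix_mult.has_vector_derivative has_mderiv)

lemma mderiv_const: "mderiv (\<lambda>t. C) t = 0"
  by (intro mderiv_eqI) simp

lemma differentiable_matrix_mult:
  fixes f g :: "real \<Rightarrow> 'a::real_normed_field^'n^'n"
  assumes "f differentiable at t" "g differentiable at t"
  shows "(\<lambda>t. f t ** g t) differentiable at t"
  using matrix_mult.FDERIV assms unfolding differentiable_def by blast

lemma mderiv_transform_open:
  assumes "open S" "t \<in> S" "\<And>s. s \<in> S \<Longrightarrow> f s = g s" "f differentiable at t"
  shows "mderiv g t = mderiv f t"
  using assms by (intro mderiv_eqI has_vector_derivative_transform_within_open[OF has_mderiv])

section \<open>Locality, composition and product rules for first order operators\<close>

lemma diff_op1_transform_open:
  assumes "open S" "t \<in> S" "\<And>s. s \<in> S \<Longrightarrow> f s = g s" "f differentiable at t"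
  shows "diff_op1 C0 C1 g t = diff_op1 C0 C1 f t"
  using mderiv_transform_open[OF assms] assms(2,3) by (simp add: diff_op1_def)

lemma differentiable_diff_op1:
  assumes "y differentiable at t" "mderiv y differentiable at t"
    "C0 differentiable at t" "C1 differentiable at t"
  shows "diff_op1 C0 C1 y differentiable at t"
  using assms unfolding diff_op1_def by (intro differentiable_add differentiable_matrix_mult)

lemmas matrix_distribs =
  matrix_mult.add_left matrix_mult.add_right matrix_mult.diff_left matrix_mult.diff_right
  matrix_mult.minus_left matrix_mult.minus_right

text \<open>The product rule, sorted by the order of the derivative of \<open>y\<close>; only the
  coefficients of the inner operator get differentiated. With \<open>\<A>\<close> inside it compares
  \<open>\<B> (\<A> y)\<close> with \<open>D y\<close>; with \<open>\<B>\<close> inside it gives the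
  coefficients of \<open>\<D>\<close>.\<close>

lemma diff_op1_diff_op1:
  assumes "y differentiable at t" "mderiv y differentiable at t"
    "C0 differentiable at t" "C1 differentiable at t"
  shows "diff_op1 E0 E1 (diff_op1 C0 C1 y) t =
    diff_op2 (\<lambda>t. C0 t ** E0 t + mderiv C0 t ** E1 t)
      (\<lambda>t. C1 t ** E0 t + C0 t ** E1 t + mderiv C1 t ** E1 t) (\<lambda>t. C1 t ** E1 t) y t"
  using assms
  by (simp add: diff_op1_def diff_op2_def mderiv_add mderiv_mult differentiable_matrix_mult
      matrix_distribs matrix_mul_assoc)

text \<open>Coefficients act on the right, so a constant left factor such as an eigenvalue passes
  through.\<close>

lemma diff_op1_const_mult:
  assumes "y differentiable at t"
  shows "diff_op1 C0 C1 (\<lambda>t. C ** y t) t = C ** diff_op1 C0 C1 y t"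
  using assms
  by (simp add: diff_op1_def mderiv_mult mderiv_const matrix_distribs matrix_mul_assoc)

text \<open>The left factor \<open>f\<close> passes through as a constant would, except for the one
  term in which the derivative falls on \<open>f\<close>.\<close>

lemma diff_op1_mult:
  assumes "f differentiable at t" "g differentiable at t"
  shows "diff_op1 C0 C1 (\<lambda>t. f t ** g t) t
    = f t ** diff_op1 C0 C1 g t + mderiv f t ** g t ** C1 t"
  using assms by (simp add: diff_op1_def mderiv_mult matrix_distribs matrix_mul_assoc)

lemma diff_op1_add:
  assumes "f differentiable at t" "g differentiable at t"
  shows "diff_op1 C0 C1 (\<lambda>t. f t + g t) t = diff_op1 C0 C1 f t + diff_op1 C0 C1 g t"
  using assms by (simp add: diff_op1_def mderiv_add matrix_distribs)

section \<open>Exchanging the two first order factors \<open>\<A>\<close> and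
  \<open>\<B>\<close>\<close>

theorem lemma7:
  fixes \<Omega> :: "real set"
    and F0 F1 F2 P U :: "real \<Rightarrow> 'a::real_normed_field^'n^'n"
    and A0 A1 B0 B1 \<Psi> :: "real \<Rightarrow> 'a^'n^'n"
    and \<Gamma> :: "'a^'n^'n"
    and D \<A> \<B> \<D> :: "(real \<Rightarrow> 'a^'n^'n) \<Rightarrow> real \<Rightarrow> 'a^'n^'n"
  assumes "open \<Omega>"
    and D: "D = diff_op2 F0 F1 F2"
    and "times_differentiable_on 2 \<Omega> P"
    and "times_differentiable_on 1 \<Omega> U"
    and "eigenfunction_on \<Omega> D \<Gamma> P"
    and "\<And>t. t \<in> \<Omega> \<Longrightarrow> invertible (P t)"
    and "\<And>t. t \<in> \<Omega> \<Longrightarrow> invertible (mderiv P t)"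
    and "\<And>t. t \<in> \<Omega> \<Longrightarrow> invertible (U t)"
    and A0: "A0 = (\<lambda>t. - U t)"
    and A1: "A1 = (\<lambda>t. matrix_inv (mderiv P t) ** P t ** U t)"
    and \<A>: "\<A> = diff_op1 A0 A1"
    and B1: "B1 = (\<lambda>t. matrix_inv (A1 t) ** F2 t)"
    and B0: "B0 = (\<lambda>t. matrix_inv (A1 t) ** (F1 t - A0 t ** B1 t - mderiv A1 t ** B1 t))"
    and \<B>: "\<B> = diff_op1 B0 B1"
    and \<Psi>: "\<Psi> = (\<lambda>t. \<B> A0 t - F0 t)"
    and \<D>: "\<D> = (\<lambda>y t. \<A> (\<B> y) t - y t ** matrix_inv (A1 t) ** \<Psi> t ** A1 t)"
  shows "(\<forall>t\<in>\<Omega>. \<A> P t = 0)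
    \<and> times_differentiable_on 1 \<Omega> \<Psi>
    \<and> (\<forall>t\<in>\<Omega>. \<A> \<Psi> t = A0 t ** matrix_inv (A1 t) ** \<Psi> t ** A1 t)
    \<and> (times_differentiable_on 1 \<Omega> B0 \<and> times_differentiable_on 1 \<Omega> B1
         \<longrightarrow> second_order_diff_op_on \<Omega> \<D>)
    \<and> (\<forall>Q \<Gamma>\<^sub>Q. times_differentiable_on 2 \<Omega> Q \<and> eigenfunction_on \<Omega> D \<Gamma>\<^sub>Q Q
         \<longrightarrow> times_differentiable_on 1 \<Omega> (\<A> Q)
           \<and> times_differentiable_on 1 \<Omega> (\<B> (\<A> Q))
           \<and> eigenfunction_on \<Omega> \<D> \<Gamma>\<^sub>Q (\<A> Q))"
proof -
  note tdo = times_differentiable_on_iff[OF \<open>open \<Omega>\<close>]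
  have dP: "P differentiable at t" "mderiv P differentiable at t" if "t \<in> \<Omega>" for t
    using assms(3) that by (auto simp: tdo)
  have invP: "invertible (P t)" "invertible (mderiv P t)" "invertible (U t)" if "t \<in> \<Omega>" for t
    using assms(6-8) that by auto
  have A1_cancel: "A1 t ** matrix_inv (A1 t) ** X = X"
    "X ** A1 t ** matrix_inv (A1 t) = X" if "t \<in> \<Omega>" for t X
  proof -
    have "invertible (A1 t)"
      unfolding A1 using invP[OF that] by (intro invertible_mult invertible_matrix_inv)
    from matrix_inv_left_right[OF this] show
      "A1 t ** matrix_inv (A1 t) ** X = X" "X ** A1 t ** matrix_inv (A1 t) = X"
      by (simp_all add: matrix_mul_assoc[symmetric])
  qed
  have dA: "A0 differentiable at t" "A1 differentiable at t" if "t \<in> \<Omega>" for t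
  proof -
    have "U differentiable at t"
      using assms(4) that unfolding tdo by blast
    then show "A0 differentiable at t" "A1 differentiable at t"
      unfolding A0 A1 using that dP invP \<open>open \<Omega>\<close>
      by (auto intro!: differentiable_matrix_mult differentiable_matrix_inv)
  qed
  have \<A>P: "\<A> P t = 0" if "t \<in> \<Omega>" for t
    by (simp add: \<A> A0 A1 diff_op1_def matrix_distribs matrix_mul_assoc[symmetric]
        matrix_inv_cancel invP that)
  have d\<A>: "\<A> y differentiable at t"
    if "y differentiable at t" "mderiv y differentiable at t" "t \<in> \<Omega>" for y t
    unfolding \<A> using that dA by (intro differentiable_diff_op1)
  have \<B>\<A>: "\<B> (\<A> y) t = y t ** \<Psi> t + D y t"
    if "y differentiable at t" "mderiv y differentiable at t" "t \<in> \<Omega>" for y t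
  proof -
    \<comment> \<open>The coefficients of \<open>y\<close>, \<open>y'\<close> and \<open>y''\<close>
      in the composition, in this order. \<open>B1\<close> and \<open>B0\<close> are the solutions
      of the last two equations; \<open>\<Psi>\<close> is the discrepancy left in the first.\<close>
    have "A0 t ** B0 t + mderiv A0 t ** B1 t = \<Psi> t + F0 t"
      by (simp add: \<Psi> \<B> diff_op1_def)
    moreover have "A1 t ** B0 t + A0 t ** B1 t + mderiv A1 t ** B1 t = F1 t"
      by (simp add: B0 matrix_mul_assoc A1_cancel that)
    moreover have "A1 t ** B1 t = F2 t"
      by (simp add: B1 matrix_mul_assoc A1_cancel that)
    ultimately show ?thesis
      unfolding \<A> \<B> using that dA
      by (simp add: diff_op1_diff_op1 D diff_op2_def) (simp add: matrix_distribs)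
  qed
  have \<Psi>_eq: "\<Psi> t = - (matrix_inv (P t) ** (\<Gamma> ** P t))" if "t \<in> \<Omega>" for t
  proof -
    \<comment> \<open>\<open>\<A> P\<close> is known to vanish only on \<open>\<Omega>\<close>, so
      locality of \<open>\<B>\<close> is needed to replace it by the zero function.\<close>
    have "\<B> (\<A> P) t = \<B> (\<lambda>_. 0) t"
      unfolding \<B> using \<A>P that
      by (intro diff_op1_transform_open[OF \<open>open \<Omega>\<close>]) auto
    then have "P t ** \<Psi> t + \<Gamma> ** P t = 0"
      using \<B>\<A>[OF dP[OF that] that] assms(5) that
      by (simp add: \<B> diff_op1_def mderiv_const eigenfunction_on_def)
    then have "P t ** \<Psi> t = - (\<Gamma> ** P t)"
      by (simp add: eq_neg_iff_add_eq_0)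
    then have "matrix_inv (P t) ** (P t ** \<Psi> t) = - (matrix_inv (P t) ** (\<Gamma> ** P t))"
      by (simp add: matrix_distribs)
    then show ?thesis
      by (simp add: matrix_inv_cancel invP that)
  qed
  have d\<Psi>: "\<Psi> differentiable at t" if "t \<in> \<Omega>" for t
  proof -
    have "(\<lambda>t. - (matrix_inv (P t) ** (\<Gamma> ** P t))) differentiable at t"
      using that dP invP \<open>open \<Omega>\<close>
      by (intro differentiable_minus differentiable_matrix_mult differentiable_matrix_inv[of \<Omega>]) auto
    then show ?thesis
      by (rule differentiable_transform_open) (use that \<open>open \<Omega>\<close> \<Psi>_eq in auto)
  qed
  have \<A>\<Psi>: "\<A> \<Psi> t = A0 t ** matrix_inv (A1 t) ** \<Psi> t ** A1 t" if "t \<in> \<Omega>" for t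
  proof -
    \<comment> \<open>The sign is absorbed into the constant left factor, so that
      \<open>\<A>\<close> commutes with it and the right-hand side is annihilated along with
      \<open>P\<close>.\<close>
    have P\<Psi>: "P s ** \<Psi> s = (- \<Gamma>) ** P s" if "s \<in> \<Omega>" for s
      using that by (simp add: \<Psi>_eq matrix_distribs matrix_inv_cancel invP)
    have "\<A> (\<lambda>s. P s ** \<Psi> s) t = \<A> (\<lambda>s. (- \<Gamma>) ** P s) t"
      unfolding \<A> using P\<Psi> that dP
      by (intro diff_op1_transform_open[OF \<open>open \<Omega>\<close>] differentiable_matrix_mult) auto
    also have "\<dots> = 0"
      using \<A>P[OF that] dP[OF that] by (simp add: \<A> diff_op1_const_mult)
    finally have "P t ** \<A> \<Psi> t = - (mderiv P t ** \<Psi> t ** A1 t)"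
      using dP[OF that] d\<Psi>[OF that] by (simp add: \<A> diff_op1_mult eq_neg_iff_add_eq_0)
    also have "mderiv P t = - (P t ** A0 t ** matrix_inv (A1 t))"
    proof -
      have "mderiv P t ** A1 t = - (P t ** A0 t)"
        using \<A>P[OF that] by (simp add: \<A> diff_op1_def eq_neg_iff_add_eq_0 add.commute)
      then have "mderiv P t ** A1 t ** matrix_inv (A1 t) = - (P t ** A0 t ** matrix_inv (A1 t))"
        by (simp add: matrix_distribs)
      then show ?thesis
        by (simp add: A1_cancel that)
    qed
    finally have "P t ** \<A> \<Psi> t = P t ** (A0 t ** matrix_inv (A1 t) ** \<Psi> t ** A1 t)"
      by (simp add: matrix_distribs matrix_mul_assoc)
    then show ?thesis
      using matrix_inv_cancel(2)[OF invP(1)[OF that]] by metis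
  qed
  have \<D>_second_order: "second_order_diff_op_on \<Omega> \<D>"
    if B: "times_differentiable_on 1 \<Omega> B0" "times_differentiable_on 1 \<Omega> B1"
  proof -
    \<comment> \<open>Expanding \<open>\<A> (\<B> y)\<close> differentiates \<open>B0\<close> and
      \<open>B1\<close>, which is where the assumptions \<open>B\<close> enter. The subtracted term
      contains no derivative of \<open>y\<close> and joins the zeroth coefficient.\<close>
    have "\<D> y t = diff_op2
        (\<lambda>t. B0 t ** A0 t + mderiv B0 t ** A1 t - matrix_inv (A1 t) ** \<Psi> t ** A1 t)
        (\<lambda>t. B1 t ** A0 t + B0 t ** A1 t + mderiv B1 t ** A1 t) (\<lambda>t. B1 t ** A1 t) y t"
      if "times_differentiable_on 2 \<Omega> y" "t \<in> \<Omega>" for y t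
      using that B unfolding tdo \<D> \<A> \<B>
      by (simp add: diff_op1_diff_op1 diff_op2_def matrix_distribs matrix_mul_assoc)
    then show ?thesis
      unfolding second_order_diff_op_on_def by blast
  qed
  have eigen: "\<A> Q differentiable at t \<and> \<B> (\<A> Q) differentiable at t
      \<and> \<D> (\<A> Q) t = \<Gamma>\<^sub>Q ** \<A> Q t"
    if "times_differentiable_on 2 \<Omega> Q" and Q_eigen: "eigenfunction_on \<Omega> D \<Gamma>\<^sub>Q Q" and t: "t \<in> \<Omega>"
    for Q \<Gamma>\<^sub>Q t
  proof -
    have dQ: "Q differentiable at s" "mderiv Q differentiable at s" if "s \<in> \<Omega>" for s
      using \<open>times_differentiable_on 2 \<Omega> Q\<close> that by (auto simp: tdo)
    have \<B>\<A>Q: "Q s ** \<Psi> s + \<Gamma>\<^sub>Q ** Q s = \<B> (\<A> Q) s" if "s \<in> \<Omega>" for s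
      using \<B>\<A>[OF dQ[OF that] that] Q_eigen that by (simp add: eigenfunction_on_def)
    have dQ\<Psi>: "(\<lambda>s. Q s ** \<Psi> s) differentiable at t" "(\<lambda>s. \<Gamma>\<^sub>Q ** Q s) differentiable at t"
      using dQ d\<Psi> t by (auto intro!: differentiable_matrix_mult)
    then have dsum: "(\<lambda>s. Q s ** \<Psi> s + \<Gamma>\<^sub>Q ** Q s) differentiable at t"
      by (rule differentiable_add)
    \<comment> \<open>Differentiability is read off from the formula through \<open>\<Psi>\<close>;
      expanding the definition of \<open>\<B>\<close> would require it of \<open>B0\<close> and
      \<open>B1\<close>.\<close>
    then have "\<B> (\<A> Q) differentiable at t"
      by (rule differentiable_transform_open[OF _ \<open>open \<Omega>\<close> t \<B>\<A>Q])
    moreover have "\<D> (\<A> Q) t = \<Gamma>\<^sub>Q ** \<A> Q t"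
    proof -
      have "\<A> (\<B> (\<A> Q)) t = \<A> (\<lambda>s. Q s ** \<Psi> s + \<Gamma>\<^sub>Q ** Q s) t"
        using diff_op1_transform_open[OF \<open>open \<Omega>\<close> t \<B>\<A>Q dsum, of A0 A1]
        by (simp only: \<A>)
      also have "\<dots> = Q t ** \<A> \<Psi> t + mderiv Q t ** \<Psi> t ** A1 t + \<Gamma>\<^sub>Q ** \<A> Q t"
        using dQ\<Psi> dQ[OF t] d\<Psi>[OF t]
        by (simp add: \<A> diff_op1_add diff_op1_mult diff_op1_const_mult mderiv_const)
      \<comment> \<open>Writing \<open>\<Psi> A1\<close> as \<open>A1 A1^-1 \<Psi> A1\<close> in the
        second summand and inserting the equation for \<open>\<A> \<Psi>\<close> in the first, both
        end in \<open>A1^-1 \<Psi> A1\<close>; what remains in front is \<open>Q A0 + Q' A1\<close>,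
        that is, \<open>\<A> Q\<close>.\<close>
      also have "Q t ** \<A> \<Psi> t + mderiv Q t ** \<Psi> t ** A1 t
          = \<A> Q t ** matrix_inv (A1 t) ** \<Psi> t ** A1 t"
        by (simp add: \<A>\<Psi>[OF t]) (simp add: \<A> diff_op1_def matrix_distribs matrix_mul_assoc A1_cancel t)
      finally show ?thesis
        by (simp add: \<D>)
    qed
    ultimately show ?thesis
      using d\<A> dQ t by blast
  qed
  show ?thesis
    using \<A>P d\<Psi> \<A>\<Psi> \<D>_second_order eigen
    unfolding tdo(1) eigenfunction_on_def by blast
qed

end
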